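(* Let $X$ be a real normed space and let $\mathcal C,\mathcal K\subset X$ be co-radiant sets such that $d_{\mathcal C}d_{\mathcal K}>0$, $\mathcal K$ is regular, $\operatorname{cl\,co}(\mathcal C)\cap\operatorname{int}(\mathcal K)\ne\varnothing$, and $(\operatorname{cone}(\mathcal C),\operatorname{cone}(\mathcal K))$ verifies the SSP. Let $0<\alpha_1<\alpha_2<1$, $f\in S_{X^*}$, $\lambda>0$ and $\eta_0>0$ be such that, for every $0<\theta<1$, every $\eta\in(0,\theta\eta_0)$ and every $\alpha\in(\alpha_1,\alpha_2)$, $$f(y')-\alpha\|y'\|<\lambda\theta<\lambda<f(y)-\alpha\|y\|\qquad\forall y'\in X\setminus\operatorname{int}(\mathcal K(\eta)),\ \forall y\in\operatorname{cl\,co}(\mathcal C).$$ Fix $\alpha\in(\alpha_1,\alpha_2)$, set $G_\alpha(y):=(\lambda-f(y)+\alpha\|y\|)_+$ for $y\in X$ and $F_\alpha:=\{y\in X:\ G_\alpha(y)=0\}$, and let $\varphi:X\to\mathbb R$ be Lipschitz. Assume that $\bar y\in F_\alpha$ solves $$\min\{\varphi(y):y\in F_\alpha\}.$$ If $$\rho>\frac{2\operatorname{Lip}(\varphi)}{1-\alpha},$$ then $\bar y$ solves $$\min\{\varphi(y)+\rho\,G_\alpha(y):y\in X\}.$$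
   Context: $X$ is a real normed space, $S_X$ its unit sphere, $B_X^\circ$ its open unit ball, $X^*$ its topological dual, $S_{X^*}$ the unit sphere of $X^*$ for the dual norm; $\operatorname{cl},\operatorname{int},\operatorname{bd},\operatorname{co}$ denote closure, interior, boundary, convex hull, and $\operatorname{cl\,co}$ the closed convex hull; $t_+:=\max\{t,0\}$. $\operatorname{Lip}(\varphi)$ is the least $L\ge0$ with $|\varphi(x)-\varphi(y)|\le L\|x-y\|$ for all $x,y\in X$. A cone is a nonempty $C\subset X$ with $\alpha C\subset C$ for all $\alpha\ge 0$; cones are assumed nontrivial ($\{0_X\}\subsetneq C\subset X$) unless otherwise stated. $\operatorname{cone}(A):=\{\lambda a:\lambda\ge 0,\ a\in A\}$. SSP: a pair of cones $(C,K)$ verifies the strict separation property (SSP) if $0_X\notin\operatorname{cl}\bigl(\operatorname{co}(C\cap S_X)-\operatorname{co}((\operatorname{bd}K\cap S_X)\cup\{0_X\})\bigr)$. Co-radiant set: $\mathcal K\subset X$ with $\lambda x\in\mathcal K$ for all $x\in\mathcal K$, $\lambda\ge 1$; co-radiant sets are assumed nonempty with $0_X\notin\mathcal K$. For $\eta>0$, $\mathcal K(\eta):=\eta\mathcal K$. Norm-base: for $t>0$, $\mathcal K\cap tS_X$ is a norm-base of $\mathcal K$ if for every $x\in\mathcal K$ there exist $y\in\mathcal K\cap tS_X$ and $\lambda>0$ with $x=\lambda y$; $\mathcal K$ admits a norm-base if this holds for some $t>0$. Interior reductions: for a cone $K$ and $\varepsilon>0$, $K^{-\varepsilon}:=K\setminus\bigl(\operatorname{cone}((\operatorname{bd}K\cap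 S_X)+\varepsilon B_X^\circ)\setminus\{0_X\}\bigr)$. For co-radiant $\mathcal K$, $\mathcal K^{-\varepsilon}:=\mathcal K\cap(\operatorname{cone}(\mathcal K))^{-\varepsilon}$. $\mathcal K$ is regular if, for every $\varepsilon>0$ with $\mathcal K^{-\varepsilon}\neq\varnothing$, the set $\mathcal K^{-\varepsilon}$ admits a norm-base. Radial profile: $\rho_{\mathcal K}:S_X\to[0,+\infty]$, $\rho_{\mathcal K}(v):=\inf\{\lambda>0:\lambda v\in\mathcal K\}$ with $\inf\varnothing=+\infty$; $\operatorname{dom}(\rho_{\mathcal K}):=\{v\in S_X:\rho_{\mathcal K}(v)<+\infty\}$; $d_{\mathcal K}:=\inf_{v\in\operatorname{dom}(\rho_{\mathcal K})}\rho_{\mathcal K}(v)$. *)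

theory Defs
  imports "HOL-Analysis.Analysis"
begin

text \<open>The cone generated by a set is the library's \<^term>\<open>cone hull A\<close>; by \<open>cone_hull_expl\<close> it equals
  \<^term>\<open>{c *\<^sub>R x | c x. 0 \<le> c \<and> x \<in> A}\<close>, also for empty \<^term>\<open>A\<close>. The inclusion of a nontrivial cone
  in the whole space is not required to be proper.\<close>

definition nontrivial_cone :: "'a::real_normed_vector set \<Rightarrow> bool" where
  "nontrivial_cone C \<longleftrightarrow> cone C \<and> {0} \<subset> C"

definition SSP :: "'a::real_normed_vector set \<Rightarrow> 'a set \<Rightarrow> bool" where
  "SSP C K \<longleftrightarrow> nontrivial_cone C \<and> nontrivial_cone K \<and>
     0 \<notin> closure {x - y | x y. x \<in> convex hull (C \<inter> sphere 0 1) \<and>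
                             y \<in> convex hull ((frontier K \<inter> sphere 0 1) \<union> {0})}"

definition co_radiant :: "'a::real_normed_vector set \<Rightarrow> bool" where
  "co_radiant K \<longleftrightarrow> K \<noteq> {} \<and> 0 \<notin> K \<and> (\<forall>x\<in>K. \<forall>c\<ge>1. c *\<^sub>R x \<in> K)"

text \<open>The cone conditions inside \<^const>\<open>SSP\<close> hold automatically for cones generated by co-radiant sets.\<close>

lemma co_radiant_nontrivial_cone:
  assumes "co_radiant K"
  shows "nontrivial_cone (cone hull K)"
proof -
  obtain x where x: "x \<in> K" "x \<noteq> 0"
    using assms unfolding co_radiant_def by auto
  have "x \<in> cone hull K"
    using x(1) by (rule hull_inc)
  moreover have "0 \<in> cone hull K"
    using x(1) by (metis cone_hull_contains_0 empty_iff)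
  ultimately show ?thesis
    using x(2) cone_cone_hull unfolding nontrivial_cone_def by blast
qed

definition norm_base :: "real \<Rightarrow> 'a::real_normed_vector set \<Rightarrow> bool" where
  "norm_base t K \<longleftrightarrow> (\<forall>x\<in>K. \<exists>y\<in>K \<inter> sphere 0 t. \<exists>c>0. x = c *\<^sub>R y)"

definition admits_norm_base :: "'a::real_normed_vector set \<Rightarrow> bool" where
  "admits_norm_base K \<longleftrightarrow> (\<exists>t>0. norm_base t K)"

definition cone_reduction :: "real \<Rightarrow> 'a::real_normed_vector set \<Rightarrow> 'a set" where
  "cone_reduction \<epsilon> K =
     K - (cone hull {x + \<epsilon> *\<^sub>R b | x b. x \<in> frontier K \<inter> sphere 0 1 \<and> b \<in> ball 0 1} - {0})"

definition co_radiant_reduction :: "real \<Rightarrow> 'a::real_normed_vector set \<Rightarrow> 'a set" where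
  "co_radiant_reduction \<epsilon> K = K \<inter> cone_reduction \<epsilon> (cone hull K)"

definition co_radiant_regular :: "'a::real_normed_vector set \<Rightarrow> bool" where
  "co_radiant_regular K \<longleftrightarrow>
     (\<forall>\<epsilon>>0. co_radiant_reduction \<epsilon> K \<noteq> {} \<longrightarrow> admits_norm_base (co_radiant_reduction \<epsilon> K))"

text \<open>The infimum is taken in \<^typ>\<open>ennreal\<close>, where the infimum of the empty set is \<open>\<infinity>\<close>. Only the values
  on the unit sphere matter.\<close>

definition radial_profile :: "'a::real_normed_vector set \<Rightarrow> 'a \<Rightarrow> ennreal" where
  "radial_profile K v = (INF c\<in>{c::real. c > 0 \<and> c *\<^sub>R v \<in> K}. ennreal c)"

definition radial_dom :: "'a::real_normed_vector set \<Rightarrow> 'a set" where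
  "radial_dom K = {v \<in> sphere 0 1. radial_profile K v < \<infinity>}"

definition radial_inf :: "'a::real_normed_vector set \<Rightarrow> ennreal" where
  "radial_inf K = (INF v\<in>radial_dom K. radial_profile K v)"

text \<open>Only meaningful for Lipschitz functions, for which the minimum exists.\<close>

definition Lip :: "('a::real_normed_vector \<Rightarrow> real) \<Rightarrow> real" where
  "Lip \<phi> = (LEAST L. L-lipschitz_on UNIV \<phi>)"

definition G_pen :: "('a::real_normed_vector \<Rightarrow>\<^sub>L real) \<Rightarrow> real \<Rightarrow> real \<Rightarrow> 'a \<Rightarrow> real" where
  "G_pen f lam \<alpha> y = max (lam - blinfun_apply f y + \<alpha> * norm y) 0"

definition F_feas :: "('a::real_normed_vector \<Rightarrow>\<^sub>L real) \<Rightarrow> real \<Rightarrow> real \<Rightarrow> 'a set" where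
  "F_feas f lam \<alpha> = {y. G_pen f lam \<alpha> y = 0}"

end

theory Submission
  imports Defs
begin

text \<open>The penalty term \<^term>\<open>G_pen f lam \<alpha>\<close> controls the distance to its zero set
  \<^term>\<open>F_feas f lam \<alpha>\<close>, and this makes it an exact penalty for every Lipschitz objective.

  Since \<^term>\<open>f\<close> has norm one and \<^term>\<open>\<alpha> < 1\<close>, some unit vector \<open>e\<close> satisfies
  \<open>f e \<ge> (1 + \<alpha>) / 2\<close>. Moving from any point \<open>y\<close> a distance \<open>s\<close> along \<open>e\<close> raises \<open>f\<close> by \<open>s * f e\<close>
  and \<open>\<alpha> * norm y\<close> by at most \<open>\<alpha> * s\<close>, so it lowers \<open>lam - f y + \<alpha> * norm y\<close> by at least
  \<open>s * (1 - \<alpha>) / 2\<close>. A step of length \<open>2 * G y / (1 - \<alpha>)\<close> therefore ends in the feasible set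
  (\<open>G_pen_error_bound\<close>). Along this step a Lipschitz \<open>\<phi>\<close> grows by at most
  \<open>Lip \<phi> * 2 * G y / (1 - \<alpha>)\<close>, which \<open>\<rho> * G y\<close> outweighs; so no infeasible point can beat
  the constrained minimum (\<open>exact_penalization\<close>).\<close>

text \<open>The Lipschitz constants form a closed set of reals that is bounded below, so the least one
  exists.\<close>

lemma Lip_lipschitz_on:
  assumes "\<exists>L. L-lipschitz_on UNIV \<phi>"
  shows "(Lip \<phi>)-lipschitz_on UNIV \<phi>"
proof -
  let ?S = "{L. L-lipschitz_on UNIV \<phi>}"
  have bdd: "bdd_below ?S"
    by (rule bdd_belowI[of _ 0]) (auto dest: lipschitz_on_nonneg)
  have ne: "?S \<noteq> {}"
    using assms by simp
  have inf: "(Inf ?S)-lipschitz_on UNIV \<phi>"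
  proof (rule lipschitz_onI)
    show "0 \<le> Inf ?S"
      using ne by (rule cInf_greatest) (auto dest: lipschitz_on_nonneg)
    fix x y
    show "dist (\<phi> x) (\<phi> y) \<le> Inf ?S * dist x y"
    proof (cases "x = y")
      case False
      have "dist (\<phi> x) (\<phi> y) / dist x y \<le> Inf ?S"
        using ne
      proof (rule cInf_greatest)
        fix L assume "L \<in> ?S"
        then show "dist (\<phi> x) (\<phi> y) / dist x y \<le> L"
          using False by (auto simp: divide_le_eq dest: lipschitz_onD)
      qed
      then show ?thesis
        using False by (simp add: divide_le_eq)
    qed simp
  qed
  have "Lip \<phi> = Inf ?S"
    unfolding Lip_def using inf by (rule Least_equality) (auto intro: cInf_lower bdd)
  with inf show ?thesis by simp
qed

lemma exists_unit_vector_above: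
  fixes f :: "'a::real_normed_vector \<Rightarrow>\<^sub>L real"
  assumes "0 \<le> c" and "c < norm f"
  shows "\<exists>e. norm e = 1 \<and> c < f e"
proof -
  obtain x where x: "c * norm x < norm (f x)"
    using norm_blinfun_bound[of c f] assms by (meson not_le)
  then have "x \<noteq> 0"
    by auto
  \<comment> \<open>The factor is the sign of the value, so that the functional is positive at the result.\<close>
  define e where "e = (sgn (f x) / norm x) *\<^sub>R x"
  have fe: "f e = \<bar>f x\<bar> / norm x"
    unfolding e_def by (simp add: blinfun.scaleR_right abs_sgn mult.commute)
  have "0 \<le> c * norm x"
    using assms(1) by simp
  then have "f x \<noteq> 0"
    using x by auto
  then have "norm e = 1"
    using \<open>x \<noteq> 0\<close> unfolding e_def by (simp add: abs_sgn_eq)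
  moreover have "c < f e"
    using x \<open>x \<noteq> 0\<close> unfolding fe by (simp add: less_divide_eq)
  ultimately show ?thesis by blast
qed

text \<open>A linear error bound for the feasible set: the witness lies on the ray from \<^term>\<open>y\<close> in the
  direction \<^term>\<open>e\<close>, and the residual decreases along that ray at rate at least
  \<^term>\<open>blinfun_apply f e - \<alpha>\<close>.\<close>

lemma G_pen_error_bound:
  fixes f :: "'a::real_normed_vector \<Rightarrow>\<^sub>L real"
  assumes e: "norm e = 1" and "0 \<le> \<alpha>" and less: "\<alpha> < f e"
  shows "\<exists>z \<in> F_feas f lam \<alpha>. (f e - \<alpha>) * dist z y \<le> G_pen f lam \<alpha> y"
proof -
  define g where "g = G_pen f lam \<alpha> y"
  define s where "s = g / (f e - \<alpha>)"
  have g: "lam - f y + \<alpha> * norm y \<le> g" "0 \<le> g"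
    unfolding g_def G_pen_def by auto
  have s: "0 \<le> s" "s * (f e - \<alpha>) = g"
    using g(2) less unfolding s_def by auto
  let ?z = "y + s *\<^sub>R e"
  have "norm ?z \<le> norm y + s"
    using norm_triangle_ineq[of y "s *\<^sub>R e"] e s(1) by simp
  then have "\<alpha> * norm ?z \<le> \<alpha> * norm y + \<alpha> * s"
    using \<open>0 \<le> \<alpha>\<close> by (metis distrib_left mult_left_mono)
  moreover have "f ?z = f y + s * f e"
    by (simp add: blinfun.add_right blinfun.scaleR_right)
  ultimately have "lam - f ?z + \<alpha> * norm ?z \<le> 0"
    using g(1) s(2) by (simp add: algebra_simps)
  then have "?z \<in> F_feas f lam \<alpha>"
    unfolding F_feas_def G_pen_def by simp
  moreover have "(f e - \<alpha>) * dist ?z y \<le> G_pen f lam \<alpha> y"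
    using e s by (simp add: dist_norm g_def mult.commute)
  ultimately show ?thesis by blast
qed

text \<open>Exact penalization from a linear error bound: replacing \<^term>\<open>y\<close> by a nearby feasible
  point costs at most \<^term>\<open>L\<close> times the distance, and the penalty pays for that.\<close>

lemma exact_penalization:
  fixes \<phi> G :: "'a::metric_space \<Rightarrow> real"
  assumes lip: "L-lipschitz_on UNIV \<phi>"
    and min: "is_arg_min \<phi> (\<lambda>y. y \<in> {y. G y = 0}) x"
    and bound: "\<And>y. \<exists>z. G z = 0 \<and> c * dist z y \<le> G y"
    and "0 \<le> \<rho>" and "L \<le> \<rho> * c"
  shows "is_arg_min (\<lambda>y. \<phi> y + \<rho> * G y) (\<lambda>y. y \<in> UNIV) x"
proof -
  have "\<phi> x + \<rho> * G x \<le> \<phi> y + \<rho> * G y" for y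
  proof -
    obtain z where z: "G z = 0" "c * dist z y \<le> G y"
      using bound by blast
    have "\<phi> x + \<rho> * G x \<le> \<phi> z"
      using min z(1) by (auto simp: is_arg_min_linorder)
    also have "\<dots> \<le> \<phi> y + L * dist z y"
      using lipschitz_onD[OF lip, of z y] by (simp add: dist_real_def)
    also have "L * dist z y \<le> \<rho> * c * dist z y"
      using \<open>L \<le> \<rho> * c\<close> by (simp add: mult_right_mono)
    also have "\<dots> \<le> \<rho> * G y"
      using mult_left_mono[OF z(2) \<open>0 \<le> \<rho>\<close>] by (simp add: mult.assoc)
    finally show ?thesis by simp
  qed
  then show ?thesis
    by (simp add: is_arg_min_linorder)
qed

theorem proposition7p14:
  fixes C K :: "'a::real_normed_vector set"
    and f :: "'a \<Rightarrow>\<^sub>L real"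
    and \<phi> :: "'a \<Rightarrow> real"
    and \<alpha>1 \<alpha>2 \<alpha> lam \<eta>0 \<rho> :: real
    and ybar :: 'a
  assumes "co_radiant C" and "co_radiant K"
    and "radial_inf C * radial_inf K > 0"
    and "co_radiant_regular K"
    and "closure (convex hull C) \<inter> interior K \<noteq> {}"
    and "SSP (cone hull C) (cone hull K)"
    and "0 < \<alpha>1" and "\<alpha>1 < \<alpha>2" and "\<alpha>2 < 1"
    and "f \<in> sphere 0 1"
    and "lam > 0" and "\<eta>0 > 0"
    and "\<forall>\<theta> \<eta> \<beta>. 0 < \<theta> \<and> \<theta> < 1 \<and> \<eta> \<in> {0<..<\<theta> * \<eta>0} \<and> \<beta> \<in> {\<alpha>1<..<\<alpha>2} \<longrightarrow>
           (\<forall>y' \<in> UNIV - interior ((*\<^sub>R) \<eta> ` K). \<forall>y \<in> closure (convex hull C).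
              blinfun_apply f y' - \<beta> * norm y' < lam * \<theta> \<and> lam * \<theta> < lam \<and>
              lam < blinfun_apply f y - \<beta> * norm y)"
    and "\<alpha> \<in> {\<alpha>1<..<\<alpha>2}"
    and "\<exists>L. L-lipschitz_on UNIV \<phi>"
    and "is_arg_min \<phi> (\<lambda>y. y \<in> F_feas f lam \<alpha>) ybar"
    and "\<rho> > 2 * Lip \<phi> / (1 - \<alpha>)"
  shows "is_arg_min (\<lambda>y. \<phi> y + \<rho> * G_pen f lam \<alpha> y) (\<lambda>y. y \<in> UNIV) ybar"
proof -
  have \<alpha>: "0 < \<alpha>" "\<alpha> < 1"
    using assms(7-9,14) by auto
  have lip: "(Lip \<phi>)-lipschitz_on UNIV \<phi>"
    using assms(15) by (rule Lip_lipschitz_on)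
  then have Lip: "0 \<le> Lip \<phi>"
    by (rule lipschitz_on_nonneg)
  \<comment> \<open>The midpoint of \<open>\<alpha>\<close> and 1 makes the slope of the error bound at least \<open>(1 - \<alpha>) / 2\<close>; this is
    the source of the factor 2 in the threshold for \<open>\<rho>\<close>.\<close>
  obtain e where e: "norm e = 1" "(1 + \<alpha>) / 2 < f e"
    using exists_unit_vector_above[of "(1 + \<alpha>) / 2" f] assms(10) \<alpha> by auto
  have "0 \<le> 2 * Lip \<phi> / (1 - \<alpha>)"
    using Lip \<alpha> by simp
  then have \<rho>: "0 \<le> \<rho>"
    using assms(17) by linarith
  have "Lip \<phi> \<le> \<rho> * ((1 - \<alpha>) / 2)"
    using assms(17) \<alpha> by (simp add: field_simps)
  also have "\<dots> \<le> \<rho> * (f e - \<alpha>)"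
    using \<rho> e(2) by (intro mult_left_mono) (simp_all add: field_simps)
  finally have slope: "Lip \<phi> \<le> \<rho> * (f e - \<alpha>)" .
  have "\<exists>z. G_pen f lam \<alpha> z = 0 \<and> (f e - \<alpha>) * dist z y \<le> G_pen f lam \<alpha> y" for y
    using G_pen_error_bound[of e \<alpha> f lam y] e \<alpha> unfolding F_feas_def by auto
  with lip assms(16)[unfolded F_feas_def] show ?thesis
    using \<rho> slope by (rule exact_penalization)
qed

end
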